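(* Let $S$ be a set. A set $P$ of $S$-probabilities is a specific set of $S$-probabilities all of whose elements are varying if and only if $P$ is a complemented Boolean generalized field of events (GFE). Moreover, every such $P$ (an orthoposet under the pointwise order and $p\mapsto 1-p$) is a concrete logic.
   Context: An $S$-probability is a function $p\colon S\to[0,1]$. A set $P$ of $S$-probabilities is partially ordered pointwise; $0,1$ denote the constant functions, $p':=1-p$, sums are pointwise. For $p,q\in P$, $p\wedge q=0$ means that the only $x\in P$ with $x\le p,q$ is $x=0$; $p\perp q$ means $p\le 1-q$. $P$ is specific if (1) $0,1\in P$; (2) $p\in P\Rightarrow 1-p\in P$; (3) $p,q\in P$, $p\wedge q=0\Rightarrow p+q\in P$. $p$ is varying if $p\le1/2$ pointwise or $p\ge 1/2$ pointwise implies $p\in\{0,1\}$. $P$ is complemented if $p\wedge p'=0$ for all $p\in P$. $P$ is a GFE if it satisfies (1), (2) and (4): $p,q\in P$, $p\perp q\Rightarrow p+q\in P$. A poset with an antitone involution $'$ (and least element $0$) is Boolean if $p\wedge q=0$ implies $p\perp q$ (i.e. $p\le q'$). A concrete logic is an orthoposet isomorphic (as an ordered set with orthocomplementation) to a collection $\Delta$ of subsets of a set $\Omega$, ordered by inclusion with complement $A\mapsto\Omega\setminus A$, such that $\emptyset,\Omega\in\Delta$, $A\in\Delta\Rightarrow\Omega\setminus A\in\Delta$, and $A,B\in\Delta$, $A\cap B=\emptyset\Rightarrow A\cup B\in\Delta$. *)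

theory Defs
  imports Complex_Main
begin

(* S is modelled by the type 'a; an S-probability is a function 'a => real with values in [0,1].
   The order on functions is Isabelle's pointwise order le_fun. *)

definition is_S_probability_set :: "('a \<Rightarrow> real) set \<Rightarrow> bool" where
  "is_S_probability_set P \<longleftrightarrow> (\<forall>p\<in>P. \<forall>s. 0 \<le> p s \<and> p s \<le> 1)"

definition pzero :: "'a \<Rightarrow> real" where "pzero = (\<lambda>_. 0)"
definition pone :: "'a \<Rightarrow> real" where "pone = (\<lambda>_. 1)"
definition pcompl :: "('a \<Rightarrow> real) \<Rightarrow> ('a \<Rightarrow> real)" where "pcompl p = (\<lambda>s. 1 - p s)"
definition padd :: "('a \<Rightarrow> real) \<Rightarrow> ('a \<Rightarrow> real) \<Rightarrow> ('a \<Rightarrow> real)" where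
  "padd p q = (\<lambda>s. p s + q s)"

definition meet_zero :: "('a \<Rightarrow> real) set \<Rightarrow> ('a \<Rightarrow> real) \<Rightarrow> ('a \<Rightarrow> real) \<Rightarrow> bool" where
  "meet_zero P p q \<longleftrightarrow> (\<forall>x\<in>P. x \<le> p \<and> x \<le> q \<longrightarrow> x = pzero)"

definition orth :: "('a \<Rightarrow> real) \<Rightarrow> ('a \<Rightarrow> real) \<Rightarrow> bool" where
  "orth p q \<longleftrightarrow> p \<le> pcompl q"

definition specific :: "('a \<Rightarrow> real) set \<Rightarrow> bool" where
  "specific P \<longleftrightarrow> pzero \<in> P \<and> pone \<in> P \<and> (\<forall>p\<in>P. pcompl p \<in> P) \<and>
     (\<forall>p\<in>P. \<forall>q\<in>P. meet_zero P p q \<longrightarrow> padd p q \<in> P)"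

definition varying :: "('a \<Rightarrow> real) \<Rightarrow> bool" where
  "varying p \<longleftrightarrow> ((\<forall>s. p s \<le> 1/2) \<or> (\<forall>s. p s \<ge> 1/2)) \<longrightarrow> p = pzero \<or> p = pone"

definition complemented :: "('a \<Rightarrow> real) set \<Rightarrow> bool" where
  "complemented P \<longleftrightarrow> (\<forall>p\<in>P. meet_zero P p (pcompl p))"

definition GFE :: "('a \<Rightarrow> real) set \<Rightarrow> bool" where
  "GFE P \<longleftrightarrow> pzero \<in> P \<and> pone \<in> P \<and> (\<forall>p\<in>P. pcompl p \<in> P) \<and>
     (\<forall>p\<in>P. \<forall>q\<in>P. orth p q \<longrightarrow> padd p q \<in> P)"

definition Boolean :: "('a \<Rightarrow> real) set \<Rightarrow> bool" where
  "Boolean P \<longleftrightarrow> (\<forall>p\<in>P. \<forall>q\<in>P. meet_zero P p q \<longrightarrow> p \<le> pcompl q)"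

definition concrete_logic_on :: "'b set \<Rightarrow> 'b set set \<Rightarrow> bool" where
  "concrete_logic_on \<Omega> \<Delta> \<longleftrightarrow> (\<forall>A\<in>\<Delta>. A \<subseteq> \<Omega>) \<and> {} \<in> \<Delta> \<and> \<Omega> \<in> \<Delta> \<and>
     (\<forall>A\<in>\<Delta>. \<Omega> - A \<in> \<Delta>) \<and> (\<forall>A\<in>\<Delta>. \<forall>B\<in>\<Delta>. A \<inter> B = {} \<longrightarrow> A \<union> B \<in> \<Delta>)"

(* P (ordered pointwise, orthocomplement p \<mapsto> 1-p) is isomorphic to a concrete logic.
   The base set is taken of type ('a \<Rightarrow> real) set set, i.e. \<Omega> is a set of subsets of P;
   this is no loss of generality (any concrete representation can be transported to one
   whose points are the sets {p. \<omega> \<in> \<phi> p}). *)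
definition concrete_logic :: "('a \<Rightarrow> real) set \<Rightarrow> bool" where
  "concrete_logic P \<longleftrightarrow> (\<exists>(\<Omega>::('a \<Rightarrow> real) set set) \<Delta> \<phi>.
     concrete_logic_on \<Omega> \<Delta> \<and> bij_betw \<phi> P \<Delta> \<and>
     (\<forall>p\<in>P. \<forall>q\<in>P. p \<le> q \<longleftrightarrow> \<phi> p \<subseteq> \<phi> q) \<and>
     (\<forall>p\<in>P. \<phi> (pcompl p) = \<Omega> - \<phi> p))"

end

theory Submission
  imports Defs
begin

text \<open>
  If every element is varying, an element lying below both some \<open>q\<close> and \<open>1 - q\<close> is at most
  \<open>1/2\<close>, hence zero; this gives the equivalence. For the representation, call a family
  of elements consistent if each finite subfamily has a common nonzero lower bound. The Boolean
  property makes a maximal consistent family contain exactly one of \<open>p\<close> and \<open>1 - p\<close>, and these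
  families serve as points. That the disjoint union of the point sets of orthogonal \<open>p\<close> and \<open>q\<close>
  is the point set of \<open>p + q\<close> amounts to the following: a nonzero element of \<open>P\<close> below \<open>p + q\<close> cannot be
  orthogonal to both \<open>p\<close> and \<open>q\<close>. The proof of this combines the Boolean property with the
  numerical fact that every nonzero element exceeds \<open>1/2\<close> somewhere.
\<close>

section \<open>From specific sets of varying elements to Boolean GFEs\<close>

lemmas prob_defs = pzero_def pone_def pcompl_def padd_def orth_def le_fun_def

lemma orth_iff: "orth p q \<longleftrightarrow> (\<forall>s. p s + q s \<le> 1)"
  by (auto simp: prob_defs algebra_simps)

lemma orth_pcompl_iff: "orth (pcompl p) q \<longleftrightarrow> q \<le> p"
  by (auto simp: orth_iff pcompl_def le_fun_def)

lemma le_half_varying_eq_pzero: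
  assumes "varying x" "\<And>s. x s \<le> 1/2"
  shows "x = pzero"
proof -
  \<comment> \<open>HOL types are inhabited, so \<open>undefined\<close> is a point at which
    \<open>pone\<close> takes the value 1 and exceeds the bound.\<close>
  have "x \<noteq> pone" using assms(2)[of undefined] by (auto simp: pone_def)
  then show ?thesis using assms by (auto simp: varying_def)
qed

lemma varying_meet_zero:
  assumes "\<forall>x\<in>P. varying x" "orth p q"
  shows "meet_zero P p q"
  unfolding meet_zero_def
proof (intro ballI impI)
  fix x assume x: "x \<in> P" "x \<le> p \<and> x \<le> q"
  have "x s \<le> 1/2" for s
  proof -
    have "x s \<le> p s" "x s \<le> q s" "p s + q s \<le> 1"
      using x assms(2) by (auto simp: orth_iff le_fun_def)
    then show ?thesis by linarith
  qed
  then show "x = pzero" using assms(1) x by (auto intro: le_half_varying_eq_pzero)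
qed

text \<open>Orthogonality and zero meet coincide here. Orthogonal elements have zero meet by
  \<open>varying_meet_zero\<close>; conversely, a zero meet puts the sum into \<open>P\<close>, and
  as an \<open>S\<close>-probability the sum is at most 1.\<close>

lemma specific_varying_imp:
  assumes "is_S_probability_set P" "specific P" "\<forall>p\<in>P. varying p"
  shows "complemented P \<and> Boolean P \<and> GFE P"
proof (intro conjI)
  show "complemented P"
    unfolding complemented_def
    by (auto intro!: varying_meet_zero[OF assms(3)] simp: orth_iff pcompl_def)
  show "Boolean P"
    unfolding Boolean_def
  proof (intro ballI impI)
    fix p q assume "p \<in> P" "q \<in> P" "meet_zero P p q"
    then have "padd p q \<in> P" using assms(2) by (auto simp: specific_def)
    then have "padd p q s \<le> 1" for s using assms(1) by (auto simp: is_S_probability_set_def)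
    then show "p \<le> pcompl q" by (auto simp: prob_defs algebra_simps)
  qed
  show "GFE P"
    using assms(2) varying_meet_zero[OF assms(3)] by (auto simp: GFE_def specific_def)
qed

section \<open>Lower bounds and sums in a complemented Boolean GFE\<close>

locale boolean_gfe =
  fixes P :: "('a \<Rightarrow> real) set"
  assumes prob: "is_S_probability_set P"
    and complemented: "complemented P"
    and boolean: "Boolean P"
    and gfe: "GFE P"
begin

lemma nonneg: "p \<in> P \<Longrightarrow> 0 \<le> p s" and le_one: "p \<in> P \<Longrightarrow> p s \<le> 1"
  using prob by (auto simp: is_S_probability_set_def)

lemma pzero_in: "pzero \<in> P" and pone_in: "pone \<in> P"
  and pcompl_in: "p \<in> P \<Longrightarrow> pcompl p \<in> P"
  and padd_in: "p \<in> P \<Longrightarrow> q \<in> P \<Longrightarrow> orth p q \<Longrightarrow> padd p q \<in> P"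
  using gfe by (auto simp: GFE_def)

text \<open>If \<open>x\<close> stayed at or below 1/2, then \<open>x\<close> itself would be a
  common lower bound of \<open>x\<close> and \<open>pcompl x\<close>.\<close>

lemma ex_gt_half:
  assumes "x \<in> P" "x \<noteq> pzero"
  shows "\<exists>s. x s > 1/2"
proof (rule ccontr)
  assume "\<not> (\<exists>s. x s > 1/2)"
  then have half: "x s \<le> 1/2" for s by (auto simp: not_less)
  have "x s \<le> 1 - x s" for s using half[of s] by linarith
  then have "x \<le> pcompl x" by (simp add: le_fun_def pcompl_def)
  then show False using assms complemented by (auto simp: complemented_def meet_zero_def)
qed

lemma orth_disjoint:
  assumes "x \<in> P" "x \<le> p" "x \<le> q" "orth p q"
  shows "x = pzero"
proof (rule ccontr)
  assume "x \<noteq> pzero"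
  then obtain s where "x s > 1/2" using ex_gt_half assms(1) by blast
  moreover have "x s \<le> p s" "x s \<le> q s" "p s + q s \<le> 1"
    using assms by (auto simp: orth_iff le_fun_def)
  ultimately show False by linarith
qed

text \<open>Contrapositive of the Boolean property, the form in which it produces new nonzero
  elements.\<close>

lemma common_lower_bound:
  assumes "p \<in> P" "q \<in> P" "\<not> orth p q"
  obtains x where "x \<in> P" "x \<noteq> pzero" "x \<le> p" "x \<le> q"
  using assms boolean unfolding Boolean_def meet_zero_def orth_def by blast

text \<open>Adding \<open>a \<le> q + r\<close> and \<open>q + r + a \<le> 1\<close> gives
  \<open>2 * a \<le> 1\<close> everywhere, against \<open>ex_gt_half\<close>.\<close>

lemma excess_not_orth:
  assumes P: "q \<in> P" "r \<in> P" "a \<in> P" and a0: "a \<noteq> pzero" and a: "a \<le> padd q r"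
  shows "\<not> orth q (padd r a)"
proof
  assume o: "orth q (padd r a)"
  obtain s where s: "a s > 1/2" using ex_gt_half P a0 by blast
  have "a s \<le> q s + r s" "q s + (r s + a s) \<le> 1"
    using a o by (auto simp: orth_iff le_fun_def padd_def)
  then show False using s by linarith
qed

text \<open>
  An offending \<open>a\<close> yields, by repeated use of the Boolean property and in either of two cases, a
  nonzero element bounded by \<open>2 - 3 * t\<close> for some \<open>t\<close> above it, hence by \<open>1/2\<close>.
\<close>

lemma no_excess:
  assumes P: "q \<in> P" "r \<in> P" "a \<in> P"
    and qr: "orth q r" and aq: "orth a q" and ar: "orth a r"
    and a: "a \<le> padd q r"
  shows "a = pzero"
proof (rule ccontr)
  assume a0: "a \<noteq> pzero"
  have qr1: "q s + r s \<le> 1" and aq1: "a s + q s \<le> 1" and ar1: "a s + r s \<le> 1"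
    and a1: "a s \<le> q s + r s" for s
    using qr aq ar a by (auto simp: orth_iff le_fun_def padd_def)
  have ra: "padd r a \<in> P" using padd_in P ar by (simp add: orth_iff add.commute)
  \<comment> \<open>This is \<open>q + r - a\<close>, written with complements and one orthogonal
    sum so that it visibly lies in \<open>P\<close>.\<close>
  define z where "z = pcompl (padd (pcompl (padd q r)) a)"
  have z: "z s = q s + r s - a s" for s by (simp add: z_def pcompl_def padd_def)
  have zP: "z \<in> P"
    unfolding z_def using P qr a1
    by (intro pcompl_in padd_in) (auto simp: orth_iff pcompl_def padd_def algebra_simps)
  have "\<not> orth q (padd r a)" using excess_not_orth P a0 a by blast
  then obtain b' where b': "b' \<in> P" "b' \<noteq> pzero" "b' \<le> q" "b' \<le> padd r a"
    using common_lower_bound[OF P(1) ra] by blast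
  \<comment> \<open>Shrinking \<open>b'\<close> settles its position relative to \<open>z\<close>:
    if it is not orthogonal to \<open>z\<close>, a nonzero common lower bound of both replaces
    it.\<close>
  obtain b where bP: "b \<in> P" and b0: "b \<noteq> pzero" and "b \<le> q" "b \<le> padd r a"
    and bz: "b \<le> z \<or> orth b z"
  proof (cases "orth b' z")
    case True
    then show ?thesis using that b' by blast
  next
    case False
    then obtain x where "x \<in> P" "x \<noteq> pzero" "x \<le> b'" "x \<le> z"
      using common_lower_bound[OF b'(1) zP] by blast
    then show ?thesis using that b' by (meson order_trans)
  qed
  have bq: "b s \<le> q s" and bra: "b s \<le> r s + a s" for s
    using \<open>b \<le> q\<close> \<open>b \<le> padd r a\<close> by (auto simp: le_fun_def padd_def)
  from bz show False
  proof
    assume "b \<le> z"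
    then have bz1: "b s \<le> q s + r s - a s" for s by (simp add: le_fun_def z)
    \<comment> \<open>Pointwise \<open>1 - r - a + b\<close>, chosen so that orthogonality to
      \<open>a\<close> would mean \<open>b \<le> r\<close>; but \<open>b\<close> is nonzero and
      already below \<open>q\<close>.\<close>
    let ?g = "padd (pcompl (padd r a)) b"
    have g: "?g \<in> P"
      using padd_in[OF pcompl_in[OF ra] bP] \<open>b \<le> padd r a\<close> by (simp add: orth_pcompl_iff)
    have "\<not> orth ?g a"
    proof
      assume "orth ?g a"
      then have "b \<le> r" by (auto simp: orth_iff le_fun_def pcompl_def padd_def)
      then show False using orth_disjoint[OF bP \<open>b \<le> q\<close> _ qr] b0 by blast
    qed
    then obtain c where c: "c \<in> P" "c \<noteq> pzero" "c \<le> ?g" "c \<le> a"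
      using common_lower_bound[OF g P(3)] by blast
    then obtain s where "c s > 1/2" using ex_gt_half by blast
    moreover have "c s \<le> 1 - (r s + a s) + b s" "c s \<le> a s"
      using c by (auto simp: le_fun_def pcompl_def padd_def)
    \<comment> \<open>The bounds chain to
      \<open>c \<le> 1 - r - a + b \<le> 1 + q - 2 * a \<le> 2 - 3 * a\<close>; with
      \<open>c \<le> a\<close> this gives \<open>4 * c \<le> 2\<close>.\<close>
    ultimately show False using bz1[of s] aq1[of s] by linarith
  next
    assume "orth b z"
    then have bz2: "b s + (q s + r s - a s) \<le> 1" for s by (simp add: orth_iff z)
    have ab: "padd a b \<in> P"
      using P bP
    proof (intro padd_in)
      have "a s + b s \<le> 1" for s using aq1[of s] bq[of s] by linarith
      then show "orth a b" by (simp add: orth_iff)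
    qed
    \<comment> \<open>The roles rotate: now \<open>b\<close> is the excess below the sum of
      \<open>r\<close> and \<open>a\<close>.\<close>
    have "\<not> orth r (padd a b)"
      using excess_not_orth[OF P(2,3) bP b0 \<open>b \<le> padd r a\<close>] .
    then obtain c where c: "c \<in> P" "c \<noteq> pzero" "c \<le> r" "c \<le> padd a b"
      using common_lower_bound[OF P(2) ab] by blast
    \<comment> \<open>As in the first case, with orthogonality to \<open>b\<close> now meaning
      \<open>c \<le> a\<close>, which is impossible since \<open>c \<le> r\<close> and
      \<open>a\<close> is orthogonal to \<open>r\<close>.\<close>
    let ?g = "padd (pcompl (padd a b)) c"
    have g: "?g \<in> P"
      using padd_in[OF pcompl_in[OF ab] c(1)] c(4) by (simp add: orth_pcompl_iff)
    have "\<not> orth ?g b"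
    proof
      assume "orth ?g b"
      then have "c \<le> a" by (auto simp: orth_iff le_fun_def pcompl_def padd_def)
      then show False using orth_disjoint[OF c(1) _ c(3) ar] c(2) by blast
    qed
    then obtain d where d: "d \<in> P" "d \<noteq> pzero" "d \<le> ?g" "d \<le> b"
      using common_lower_bound[OF g bP] by blast
    then obtain s where "d s > 1/2" using ex_gt_half by blast
    moreover have "d s \<le> 1 - (a s + b s) + c s" "d s \<le> b s" "c s \<le> r s"
      using c d by (auto simp: le_fun_def pcompl_def padd_def)
    \<comment> \<open>Here \<open>d \<le> 1 - a - b + r \<le> 2 - 2 * b - q \<le> 2 - 3 * b\<close>;
      with \<open>d \<le> b\<close> this gives \<open>4 * d \<le> 2\<close>.\<close>
    ultimately show False using bz2[of s] bq[of s] by linarith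
  qed
qed

section \<open>Maximal consistent families\<close>

definition consistent :: "('a \<Rightarrow> real) set \<Rightarrow> bool" where
  "consistent F \<longleftrightarrow> F \<subseteq> P \<and> (\<forall>A. finite A \<and> A \<subseteq> F \<longrightarrow> (\<exists>x\<in>P. x \<noteq> pzero \<and> (\<forall>p\<in>A. x \<le> p)))"

lemma consistentD:
  assumes "consistent F" "finite A" "A \<subseteq> F"
  obtains x where "x \<in> P" "x \<noteq> pzero" "\<And>p. p \<in> A \<Longrightarrow> x \<le> p"
  using assms unfolding consistent_def by meson

text \<open>These play the part of ultrafilters in Stone's representation. Meets are not assumed to
  exist, so nonzero lower bounds in \<open>P\<close>, not necessarily in the family, replace
  them.\<close>

definition points :: "('a \<Rightarrow> real) set set" where
  "points = {F. consistent F \<and> (\<forall>G. consistent G \<and> F \<subseteq> G \<longrightarrow> G = F)}"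

lemma points_consistent: "F \<in> points \<Longrightarrow> consistent F"
  by (simp add: points_def)

lemma points_subset: "F \<in> points \<Longrightarrow> F \<subseteq> P"
  by (simp add: points_def consistent_def)

text \<open>Zorn's lemma applies because consistency is a condition on finite subfamilies, and a
  finite part of the union of a chain lies in one member.\<close>

lemma ex_point:
  assumes A: "A \<subseteq> P" and x: "x \<in> P" "x \<noteq> pzero" "\<And>p. p \<in> A \<Longrightarrow> x \<le> p"
  shows "\<exists>F\<in>points. A \<subseteq> F"
proof -
  let ?S = "{F. consistent F \<and> A \<subseteq> F}"
  have "consistent A" unfolding consistent_def using A x by blast
  then have "A \<in> ?S" by simp
  have "\<exists>M\<in>?S. \<forall>X\<in>?S. M \<subseteq> X \<longrightarrow> X = M"
  proof (rule subset_Zorn_nonempty)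
    show "?S \<noteq> {}" using \<open>A \<in> ?S\<close> by blast
    fix C assume C: "C \<noteq> {}" "subset.chain ?S C"
    then have sub: "C \<subseteq> ?S" by (simp add: subset.chain_def)
    have "consistent (\<Union>C)"
      unfolding consistent_def
    proof (intro conjI allI impI)
      show "\<Union>C \<subseteq> P" using sub by (auto simp: consistent_def)
      fix B assume "finite B \<and> B \<subseteq> \<Union>C"
      then obtain F where "F \<in> C" "B \<subseteq> F"
        using finite_subset_Union_chain[of B C] C by blast
      then show "\<exists>x\<in>P. x \<noteq> pzero \<and> (\<forall>p\<in>B. x \<le> p)"
        using sub \<open>finite B \<and> B \<subseteq> \<Union>C\<close> by (auto simp: consistent_def)
    qed
    then show "\<Union>C \<in> ?S" using C(1) sub by auto
  qed
  then obtain M where M: "consistent M" "A \<subseteq> M"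
    and max: "\<forall>X\<in>?S. M \<subseteq> X \<longrightarrow> X = M"
    by blast
  have "M \<in> points"
    unfolding points_def using M max by (blast intro: order_trans)
  then show ?thesis using M by blast
qed

text \<open>By maximality, adjoining \<open>p\<close> destroys consistency; \<open>A\<close> is a
  finite witness of this with \<open>p\<close> removed.\<close>

lemma not_in_point:
  assumes F: "F \<in> points" and p: "p \<in> P" "p \<notin> F"
  obtains A where "finite A" "A \<subseteq> F"
    "\<forall>x\<in>P. (\<forall>q\<in>A. x \<le> q) \<and> x \<le> p \<longrightarrow> x = pzero"
proof -
  have "\<not> consistent (insert p F)" using F p by (auto simp: points_def)
  moreover have "insert p F \<subseteq> P" using points_subset F p by blast
  ultimately obtain B where B: "finite B" "B \<subseteq> insert p F"
    "\<not> (\<exists>x\<in>P. x \<noteq> pzero \<and> (\<forall>q\<in>B. x \<le> q))"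
    unfolding consistent_def by blast
  show ?thesis
  proof (rule that)
    show "finite (B - {p})" "B - {p} \<subseteq> F" using B by auto
    show "\<forall>x\<in>P. (\<forall>q\<in>B - {p}. x \<le> q) \<and> x \<le> p \<longrightarrow> x = pzero" using B(3) by blast
  qed
qed

text \<open>If both were missing, finite \<open>A\<close> and \<open>B\<close> would witness it. A
  nonzero lower bound \<open>x\<close> of their union is either orthogonal to \<open>p\<close>,
  hence below \<open>pcompl p\<close>, or shares a nonzero lower bound with \<open>p\<close>; each
  contradicts a witness.\<close>

lemma pcompl_in_point_iff:
  assumes F: "F \<in> points" and p: "p \<in> P"
  shows "pcompl p \<in> F \<longleftrightarrow> p \<notin> F"
proof
  assume "pcompl p \<in> F"
  show "p \<notin> F"
  proof
    assume "p \<in> F"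
    then obtain x where "x \<in> P" "x \<noteq> pzero" "x \<le> p" "x \<le> pcompl p"
      using consistentD[OF points_consistent[OF F], of "{p, pcompl p}"] \<open>pcompl p \<in> F\<close>
      by (metis empty_subsetI finite.emptyI finite.insertI insertCI insert_subset)
    then show False using complemented p by (auto simp: complemented_def meet_zero_def)
  qed
next
  assume "p \<notin> F"
  show "pcompl p \<in> F"
  proof (rule ccontr)
    assume "pcompl p \<notin> F"
    obtain A where A: "finite A" "A \<subseteq> F"
      and A0: "\<forall>x\<in>P. (\<forall>q\<in>A. x \<le> q) \<and> x \<le> p \<longrightarrow> x = pzero"
      using not_in_point[OF F p \<open>p \<notin> F\<close>] by blast
    obtain B where B: "finite B" "B \<subseteq> F"
      and B0: "\<forall>x\<in>P. (\<forall>q\<in>B. x \<le> q) \<and> x \<le> pcompl p \<longrightarrow> x = pzero"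
      using not_in_point[OF F pcompl_in[OF p] \<open>pcompl p \<notin> F\<close>] by blast
    obtain x where x: "x \<in> P" "x \<noteq> pzero" "\<And>q. q \<in> A \<union> B \<Longrightarrow> x \<le> q"
      using consistentD[OF points_consistent[OF F], of "A \<union> B"] A B by (metis finite_Un le_sup_iff)
    show False
    proof (cases "orth x p")
      case True
      then show False using B0 x by (auto simp: orth_def)
    next
      case False
      then obtain y where "y \<in> P" "y \<noteq> pzero" "y \<le> x" "y \<le> p"
        using common_lower_bound[OF x(1) p] by blast
      then show False using A0 x(3) by (meson UnI1 order_trans)
    qed
  qed
qed

lemma point_mono:
  assumes F: "F \<in> points" and "p \<in> F" "q \<in> P" "p \<le> q"
  shows "q \<in> F"
proof (rule ccontr)
  assume "q \<notin> F"
  then have "pcompl q \<in> F" using pcompl_in_point_iff assms by blast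
  then obtain x where "x \<in> P" "x \<noteq> pzero" "x \<le> p" "x \<le> pcompl q"
    using consistentD[OF points_consistent[OF F], of "{p, pcompl q}"] \<open>p \<in> F\<close>
    by (metis empty_subsetI finite.emptyI finite.insertI insertCI insert_subset)
  then show False
    using complemented assms by (meson complemented_def meet_zero_def order_trans)
qed

lemma padd_in_point_iff:
  assumes F: "F \<in> points" and P: "p \<in> P" "q \<in> P" and o: "orth p q"
  shows "padd p q \<in> F \<longleftrightarrow> p \<in> F \<or> q \<in> F"
proof
  assume s: "padd p q \<in> F"
  show "p \<in> F \<or> q \<in> F"
  proof (rule ccontr)
    assume "\<not> (p \<in> F \<or> q \<in> F)"
    \<comment> \<open>A nonzero lower bound of these three elements is exactly what
      \<open>no_excess\<close> forbids.\<close>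
    then have "{padd p q, pcompl p, pcompl q} \<subseteq> F" using s pcompl_in_point_iff F P by blast
    then obtain x where x: "x \<in> P" "x \<noteq> pzero"
      "x \<le> padd p q" "x \<le> pcompl p" "x \<le> pcompl q"
      using consistentD[OF points_consistent[OF F] _ \<open>_ \<subseteq> F\<close>]
      by (metis finite.emptyI finite.insertI insertCI)
    then show False using no_excess[OF P x(1) o] by (auto simp: orth_def)
  qed
next
  have "p \<le> padd p q" "q \<le> padd p q" using P nonneg by (auto simp: le_fun_def padd_def)
  then show "p \<in> F \<or> q \<in> F \<Longrightarrow> padd p q \<in> F"
    using point_mono[OF F] padd_in[OF P o] by blast
qed

section \<open>The set representation\<close>

definition point_set :: "('a \<Rightarrow> real) \<Rightarrow> ('a \<Rightarrow> real) set set" where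
  "point_set p = {F \<in> points. p \<in> F}"

text \<open>Otherwise \<open>p\<close> and \<open>q\<close> have a nonzero common lower bound, so
  \<open>{p, q}\<close> extends to a point lying in both sets.\<close>

lemma orth_if_disjoint:
  assumes "p \<in> P" "q \<in> P" "point_set p \<inter> point_set q = {}"
  shows "orth p q"
proof (rule ccontr)
  assume "\<not> orth p q"
  then obtain x where "x \<in> P" "x \<noteq> pzero" "x \<le> p" "x \<le> q"
    using common_lower_bound assms by blast
  then have "\<exists>F\<in>points. {p, q} \<subseteq> F" using assms by (intro ex_point[of _ x]) auto
  then show False using assms(3) by (auto simp: point_set_def)
qed

lemma point_set_pcompl:
  assumes "p \<in> P"
  shows "point_set (pcompl p) = points - point_set p"
  using pcompl_in_point_iff assms by (auto simp: point_set_def)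

text \<open>The order is reflected because \<open>p \<le> q\<close> is orthogonality of
  \<open>p\<close> to \<open>pcompl q\<close>, which disjointness of their point sets
  provides.\<close>

lemma le_iff_point_set_subset:
  assumes P: "p \<in> P" "q \<in> P"
  shows "p \<le> q \<longleftrightarrow> point_set p \<subseteq> point_set q"
proof
  show "p \<le> q \<Longrightarrow> point_set p \<subseteq> point_set q"
    using point_mono P by (auto simp: point_set_def)
  assume "point_set p \<subseteq> point_set q"
  then have "orth p (pcompl q)"
    using P by (intro orth_if_disjoint) (auto simp: pcompl_in point_set_pcompl)
  then show "p \<le> q" by (simp add: prob_defs)
qed

lemma point_set_pone: "point_set pone = points"
proof -
  have "pone \<in> F" if F: "F \<in> points" for F
  proof -
    \<comment> \<open>An element of \<open>P\<close> below \<open>pcompl pone\<close> is also below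
      \<open>pone\<close>, so complementedness makes it zero.\<close>
    have "pcompl pone \<notin> F"
    proof
      assume "pcompl pone \<in> F"
      then obtain x where "x \<in> P" "x \<noteq> pzero" "x \<le> pcompl pone"
        using consistentD[OF points_consistent[OF F], of "{pcompl pone}"]
        by (metis empty_subsetI finite.emptyI finite.insertI insertCI insert_subset)
      moreover from this have "x \<le> pone" using le_one by (auto simp: le_fun_def pone_def)
      ultimately show False
        using complemented pone_in by (auto simp: complemented_def meet_zero_def)
    qed
    then show ?thesis using pcompl_in_point_iff F pone_in by blast
  qed
  then show ?thesis by (auto simp: point_set_def)
qed

theorem concrete_logic: "concrete_logic P"
  unfolding concrete_logic_def
proof (intro exI conjI)
  show "concrete_logic_on points (point_set ` P)"
    unfolding concrete_logic_on_def
  proof (intro conjI)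
    show "\<forall>A\<in>point_set ` P. A \<subseteq> points" by (auto simp: point_set_def)
    show one: "points \<in> point_set ` P" using point_set_pone pone_in by blast
    show compl: "\<forall>A\<in>point_set ` P. points - A \<in> point_set ` P"
      using point_set_pcompl pcompl_in by (metis (no_types, lifting) imageE imageI)
    show "{} \<in> point_set ` P" using bspec[OF compl one] by simp
    show "\<forall>A\<in>point_set ` P. \<forall>B\<in>point_set ` P. A \<inter> B = {} \<longrightarrow> A \<union> B \<in> point_set ` P"
    proof clarify
      fix p q assume P: "p \<in> P" "q \<in> P" "point_set p \<inter> point_set q = {}"
      then have o: "orth p q" by (rule orth_if_disjoint)
      then have "point_set p \<union> point_set q = point_set (padd p q)"
        using padd_in_point_iff P by (auto simp: point_set_def)
      then show "point_set p \<union> point_set q \<in> point_set ` P" using padd_in P o by blast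
    qed
  qed
  show "bij_betw point_set P (point_set ` P)"
    using le_iff_point_set_subset by (intro inj_on_imp_bij_betw inj_onI antisym) auto
  show "\<forall>p\<in>P. \<forall>q\<in>P. p \<le> q \<longleftrightarrow> point_set p \<subseteq> point_set q"
    using le_iff_point_set_subset by blast
  show "\<forall>p\<in>P. point_set (pcompl p) = points - point_set p"
    using point_set_pcompl by blast
qed

section \<open>The converse implication and the conclusion\<close>

lemma specific: "specific P"
  unfolding specific_def
  using pzero_in pone_in pcompl_in padd_in boolean unfolding Boolean_def orth_def by blast

lemma varying: "p \<in> P \<Longrightarrow> varying p"
  unfolding varying_def
proof
  assume p: "p \<in> P" and "(\<forall>s. p s \<le> 1/2) \<or> (\<forall>s. p s \<ge> 1/2)"
  then show "p = pzero \<or> p = pone"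
  proof (elim disjE)
    assume "\<forall>s. p s \<le> 1/2"
    then show ?thesis using ex_gt_half p by (meson not_less)
  next
    assume "\<forall>s. p s \<ge> 1/2"
    then have "\<forall>s. pcompl p s \<le> 1/2" by (simp add: pcompl_def)
    then have "pcompl p = pzero" using ex_gt_half pcompl_in p by (meson not_less)
    then show ?thesis by (auto simp: pcompl_def pzero_def pone_def fun_eq_iff)
  qed
qed

end

theorem theorem2p4:
  fixes P :: "('a \<Rightarrow> real) set"
  assumes "is_S_probability_set P"
  shows "((specific P \<and> (\<forall>p\<in>P. varying p)) \<longleftrightarrow> (complemented P \<and> Boolean P \<and> GFE P))
         \<and> (specific P \<and> (\<forall>p\<in>P. varying p) \<longrightarrow> concrete_logic P)"
proof -
  have gfe: "boolean_gfe P" if "complemented P \<and> Boolean P \<and> GFE P"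
    using that assms by (simp add: boolean_gfe_def)
  have "specific P \<and> (\<forall>p\<in>P. varying p)" if "complemented P \<and> Boolean P \<and> GFE P"
    using boolean_gfe.specific boolean_gfe.varying gfe[OF that] by blast
  moreover have "complemented P \<and> Boolean P \<and> GFE P" if "specific P \<and> (\<forall>p\<in>P. varying p)"
    using specific_varying_imp assms that by blast
  ultimately show ?thesis using boolean_gfe.concrete_logic gfe by blast
qed

end
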